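(* Let $G$ be a finite simple connected graph with minimum degree $\delta$ and maximum degree $\Delta$. If $\delta \geq 2$, then $D'(G)\leq \lceil \sqrt[\delta]{\Delta}\,\rceil + 1$.
   Context: The distinguishing index $D'(G)$ of a graph $G$ is the least number $d$ such that $G$ has an edge labeling with $d$ labels (an arbitrary map from $E(G)$ to a set of $d$ labels, not necessarily a proper edge colouring) that is preserved only by the identity automorphism of $G$. An automorphism $\varphi$ of $G$ preserves an edge labeling $c$ if $c(\varphi(u)\varphi(w)) = c(uw)$ for every edge $uw\in E(G)$. Here $\sqrt[\delta]{\Delta}=\Delta^{1/\delta}$. *)

theory Defs
  imports Complex_Main "HOL-Library.Extended_Nat" "Graph_Theory.Graph_Theory"
begin

text \<open>
  A finite simple graph is a \<^locale>\<open>pair_graph\<close>: a finite loop-free digraph with symmetric arc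
  set. An undirected edge is thus a pair of opposite arcs, and the degree of a vertex is its
  out-degree.
\<close>

definition min_degree :: "'a pair_pre_digraph \<Rightarrow> nat" where
  "min_degree G = Min (out_degree (with_proj G) ` pverts G)"

definition max_degree :: "'a pair_pre_digraph \<Rightarrow> nat" where
  "max_degree G = Max (out_degree (with_proj G) ` pverts G)"

definition edges :: "'a pair_pre_digraph \<Rightarrow> 'a set set" where
  "edges G = {{u, w} | u w. (u, w) \<in> parcs G}"

text \<open>Values of an automorphism outside the vertex set are irrelevant.\<close>

definition graph_automorphism :: "'a pair_pre_digraph \<Rightarrow> ('a \<Rightarrow> 'a) \<Rightarrow> bool" where
  "graph_automorphism G \<phi> \<longleftrightarrow> bij_betw \<phi> (pverts G) (pverts G) \<and>
     (\<forall>u\<in>pverts G. \<forall>w\<in>pverts G. (u, w) \<in> parcs G \<longleftrightarrow> (\<phi> u, \<phi> w) \<in> parcs G)"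

definition preserves_labeling ::
  "'a pair_pre_digraph \<Rightarrow> ('a \<Rightarrow> 'a) \<Rightarrow> ('a set \<Rightarrow> 'l) \<Rightarrow> bool" where
  "preserves_labeling G \<phi> c \<longleftrightarrow> (\<forall>u w. {u, w} \<in> edges G \<longrightarrow> c {\<phi> u, \<phi> w} = c {u, w})"

definition distinguishing_labeling :: "'a pair_pre_digraph \<Rightarrow> ('a set \<Rightarrow> 'l) \<Rightarrow> bool" where
  "distinguishing_labeling G c \<longleftrightarrow>
     (\<forall>\<phi>. graph_automorphism G \<phi> \<and> preserves_labeling G \<phi> c \<longrightarrow> (\<forall>v\<in>pverts G. \<phi> v = v))"

text \<open>
  The labels are \<open>0, \<dots>, d - 1\<close>. Some graphs, such as the one with two vertices and one edge, have
  no distinguishing edge labeling at all; their index is the infimum of the empty set, \<open>\<infinity>\<close>.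
\<close>

definition distinguishing_index :: "'a pair_pre_digraph \<Rightarrow> enat" where
  "distinguishing_index G =
     Inf (enat ` {d. \<exists>c :: 'a set \<Rightarrow> nat. c ` edges G \<subseteq> {..<d} \<and> distinguishing_labeling G c})"

end

(*
  Put k = ceiling of the delta-th root of Delta, so that k ^ delta >= Delta, and take a longest path
  p. If p is spanning, label its first edge 1, its other edges 0 and everything else 2. Otherwise the
  ends of p are not adjacent, and all neighbours of its first vertex r lie on p. Let depth-first
  search from r descend along p first. In the resulting spanning tree the ends of every edge are
  comparable, so all neighbours of a leaf are ancestors. There are at least delta of them, so the
  labels 1, ..., k of the edges at a leaf can spell out the delta base-k digits of any index below
  k ^ delta. Tree edges between inner vertices get label 0, one non-tree edge rz gets label 1 and the
  remaining edges label 2. This pins down r, and a label-preserving automorphism then preserves the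
  tree and the indices of the leaves.

  The m children of an inner vertex of index s get the indices s, s + 1, ..., s + m - 1 modulo
  k ^ delta. As 0 < m < k ^ delta, this cyclic interval determines s, so going up the tree the
  automorphism preserves all indices; as the indices of siblings differ, going down the tree it fixes
  all vertices.
*)

theory Submission
  imports Defs
begin

section \<open>Digits, cyclic intervals and ranks\<close>

lemma mod_power_digits_eq:
  fixes a b k :: nat
  assumes "\<And>i. i < d \<Longrightarrow> a div k ^ i mod k = b div k ^ i mod k"
  shows "a mod k ^ d = b mod k ^ d"
  using assms
proof (induction d)
  case (Suc d)
  have "a mod k ^ d = b mod k ^ d" using Suc by simp
  moreover have "a div k ^ d mod k = b div k ^ d mod k" using Suc.prems by simp
  ultimately show ?case
    using mod_mult2_eq[of a "k ^ d" k] mod_mult2_eq[of b "k ^ d" k]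
    by (simp add: mult.commute)
qed simp

text \<open>If \<open>s\<close> and \<open>t\<close> differed, \<open>s\<close> would sit at a
  positive offset in the interval from \<open>t\<close>, so its cyclic predecessor would lie in the
  common set as well. In the interval from \<open>s\<close> that predecessor comes only after a full
  turn, too late since \<open>m < N\<close>.\<close>

lemma cyclic_window_start_unique:
  fixes s t m N :: nat
  assumes eq: "(\<lambda>i. (s + i) mod N) ` {..<m} = (\<lambda>i. (t + i) mod N) ` {..<m}"
    and m: "0 < m" "m < N" and "s < N" "t < N"
  shows "s = t"
proof (rule ccontr)
  assume "s \<noteq> t"
  have "s \<in> (\<lambda>i. (s + i) mod N) ` {..<m}"
    using assms by (intro image_eqI[of _ _ 0]) auto
  then obtain i where i: "i < m" "s = (t + i) mod N" using eq by auto
  with \<open>s \<noteq> t\<close> \<open>t < N\<close> obtain i' where i': "i = Suc i'" by (cases i) auto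
  have "(t + i') mod N \<in> (\<lambda>i. (t + i) mod N) ` {..<m}" using i i' by auto
  then obtain j where j: "j < m" "(t + i') mod N = (s + j) mod N" using eq by force
  have "s mod N = Suc (s + j) mod N"
    using i i' j by (metis add_Suc_right mod_Suc_eq mod_mod_trivial)
  then show False using j m \<open>s < N\<close> by (auto simp: mod_if split: if_splits)
qed

text \<open>Meant for the neighbours of a leaf ordered by depth: each digit position finds a
  neighbour to carry it. Removing the element with the largest \<open>h\<close> leaves the other
  ranks unchanged.\<close>

lemma exists_rank:
  fixes h :: "'a \<Rightarrow> nat"
  assumes "finite A" "inj_on h A" "i < card A"
  shows "\<exists>a\<in>A. card {b\<in>A. h b < h a} = i"
  using assms
proof (induction "card A" arbitrary: A)
  case (Suc n)
  then have ne: "A \<noteq> {}" by auto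
  have "Max (h ` A) \<in> h ` A" using ne Suc.prems(1) by simp
  then obtain a where "a \<in> A" "h a = Max (h ` A)" by force
  then have a: "a \<in> A" "\<And>b. b \<in> A \<Longrightarrow> h b \<le> h a" using Suc.prems(1) by auto
  have lt: "h b < h a" if "b \<in> A - {a}" for b
    using a that Suc.prems(2) by (metis DiffD1 DiffD2 inj_onD insertI1 le_neq_implies_less)
  show ?case
  proof (cases "i = n")
    case True
    have "{b\<in>A. h b < h a} = A - {a}" using lt by auto
    then show ?thesis using True Suc a by (intro bexI[of _ a]) auto
  next
    case False
    then have "\<exists>c\<in>A - {a}. card {b\<in>A - {a}. h b < h c} = i"
      using Suc a by (intro Suc.hyps(1)) (auto intro: inj_on_diff)
    then obtain c where c: "c \<in> A - {a}" "card {b\<in>A - {a}. h b < h c} = i" by blast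
    have "{b\<in>A - {a}. h b < h c} = {b\<in>A. h b < h c}" using lt[OF c(1)] by auto
    then show ?thesis using c by auto
  qed
qed simp

section \<open>Normal trees given by their root paths\<close>

text \<open>
  \<open>pth x\<close> lists the vertices on the tree path from the root \<open>r\<close> to \<open>x\<close>. Edges of \<open>adj\<close> may leave
  \<open>V\<close>, since the search below applies this to the set of visited vertices.
\<close>

locale normal_tree =
  fixes V :: "'a set" and adj :: "'a \<Rightarrow> 'a \<Rightarrow> bool" and r :: 'a and pth :: "'a \<Rightarrow> 'a list"
  assumes root_mem: "r \<in> V"
    and pth_ne: "x \<in> V \<Longrightarrow> pth x \<noteq> []"
    and hd_pth: "x \<in> V \<Longrightarrow> hd (pth x) = r"
    and last_pth: "x \<in> V \<Longrightarrow> last (pth x) = x"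
    and distinct_pth: "x \<in> V \<Longrightarrow> distinct (pth x)"
    and set_pth: "x \<in> V \<Longrightarrow> set (pth x) \<subseteq> V"
    and prefix_pth: "x \<in> V \<Longrightarrow> pth x = as @ y # bs \<Longrightarrow> pth y = as @ [y]"
    and successively_pth: "x \<in> V \<Longrightarrow> successively adj (pth x)"
    and comparable: "x \<in> V \<Longrightarrow> y \<in> V \<Longrightarrow> adj x y \<Longrightarrow> x \<in> set (pth y) \<or> y \<in> set (pth x)"
begin

lemma pth_root: "pth r = [r]"
proof -
  have "pth r = [] @ r # tl (pth r)"
    using pth_ne hd_pth root_mem by (metis append_Nil list.collapse)
  then show ?thesis using prefix_pth root_mem by fastforce
qed

lemma self_in_pth: "x \<in> V \<Longrightarrow> x \<in> set (pth x)"
  using last_pth pth_ne last_in_set by metis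

lemma butlast_pth: "x \<in> V \<Longrightarrow> pth x = butlast (pth x) @ [x]"
  using last_pth pth_ne append_butlast_last_id by metis

definition child :: "'a \<Rightarrow> 'a \<Rightarrow> bool" where
  "child x y \<longleftrightarrow> x \<in> V \<and> y \<in> V \<and> pth y = pth x @ [y]"

definition leaf :: "'a \<Rightarrow> bool" where
  "leaf x \<longleftrightarrow> (\<forall>y. \<not> child x y)"

lemma child_adj: "child x y \<Longrightarrow> adj x y"
  using successively_pth[of y] last_pth pth_ne
  unfolding child_def by (auto simp: successively_append_iff)

lemma parent_exists:
  assumes "y \<in> V" "y \<noteq> r"
  obtains x where "child x y"
proof -
  have ne: "butlast (pth y) \<noteq> []"
    using assms butlast_pth[of y] hd_pth[of y] by (metis append_Nil list.sel(1))
  define x where "x = last (butlast (pth y))"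
  have eq: "pth y = butlast (butlast (pth y)) @ x # [y]"
    using butlast_pth[OF assms(1)] ne unfolding x_def
    by (metis append.assoc append_Cons append_Nil append_butlast_last_id)
  have "pth x = butlast (butlast (pth y)) @ [x]" using prefix_pth[OF assms(1) eq] .
  moreover have "x \<in> V" using eq set_pth[OF assms(1)] by (metis in_set_conv_decomp subsetD)
  ultimately show ?thesis using eq assms by (intro that[of x]) (simp add: child_def)
qed

lemma proper_ancestor:
  assumes "y \<in> V" "x \<in> set (pth y)" "x \<noteq> y"
  shows "\<not> leaf x" "length (pth x) < length (pth y)"
proof -
  obtain as bs where eq: "pth y = as @ x # bs" using assms(2) by (meson split_list)
  have bs: "bs \<noteq> []" using eq assms last_pth by force
  have px: "pth x = as @ [x]" using prefix_pth[OF assms(1) eq] .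
  then obtain b bs' where b: "bs = b # bs'" using bs by (cases bs) auto
  have "pth b = (as @ [x]) @ [b]" using prefix_pth[OF assms(1), of "as @ [x]" b bs'] eq b by simp
  moreover have "x \<in> V" "b \<in> V" using set_pth[OF assms(1)] eq b by auto
  ultimately show "\<not> leaf x" using px unfolding leaf_def child_def by auto
  show "length (pth x) < length (pth y)" using px eq bs by simp
qed

text \<open>The length of a root path is the position of its end on \<open>pth y\<close>. Hence
  depth separates the neighbours of a leaf, which are all ancestors of it.\<close>

lemma chain_pth_inj:
  assumes "y \<in> V"
  shows "inj_on (\<lambda>x. length (pth x)) (set (pth y))"
proof (rule inj_onI)
  fix a b assume a: "a \<in> set (pth y)" and b: "b \<in> set (pth y)" and l: "length (pth a) = length (pth b)"
  obtain as as' where ea: "pth y = as @ a # as'" using a by (meson split_list)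
  obtain bs bs' where eb: "pth y = bs @ b # bs'" using b by (meson split_list)
  have "length as = length bs" using l prefix_pth[OF assms ea] prefix_pth[OF assms eb] by simp
  then show "a = b" using ea eb by simp
qed

end

section \<open>Depth-first search\<close>

text \<open>
  The vertices of \<open>S\<close> have been visited, and \<open>st\<close> is the stack: the tree path from the root to the
  vertex from which the search continues.
\<close>

definition dfs_state where
  "dfs_state V adj r S f st \<longleftrightarrow> normal_tree S adj r f \<and> S \<subseteq> V \<and> st \<noteq> [] \<and> last st \<in> S \<and>
     f (last st) = st \<and> (\<forall>x\<in>S - set st. \<forall>y\<in>V. adj x y \<longrightarrow> y \<in> S)"

lemma dfs_init: "r \<in> V \<Longrightarrow> dfs_state V adj r {r} (\<lambda>_. [r]) [r]"
  unfolding dfs_state_def normal_tree_def by (auto simp: Cons_eq_append_conv)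

text \<open>Vertices off the stack have no unvisited neighbours, so every visited neighbour of the
  new vertex \<open>y\<close> is on the stack and thus an ancestor of \<open>y\<close>. This keeps
  adjacent vertices comparable.\<close>

lemma dfs_push:
  assumes st: "dfs_state V adj r S f st" and sym: "symp adj"
    and y: "y \<in> V" "y \<notin> S" "adj (last st) y" "\<not> adj y y"
  shows "dfs_state V adj r (insert y S) (f(y := st @ [y])) (st @ [y])"
proof -
  interpret normal_tree S adj r f using st by (simp add: dfs_state_def)
  have stf: "f (last st) = st" "last st \<in> S" "st \<noteq> []" using st by (auto simp: dfs_state_def)
  have stS: "set st \<subseteq> S" using set_pth stf by metis
  have yst: "y \<notin> set st" using stS y by auto
  have dist: "distinct st" using distinct_pth stf by metis
  have hd: "hd st = r" using hd_pth stf by metis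
  have succ: "successively adj st" using successively_pth stf by metis
  have setf: "\<And>x u. x \<in> S \<Longrightarrow> u \<in> set (f x) \<Longrightarrow> u \<in> S" using set_pth by blast
  have pre: "f u = as @ [u]" if "st = as @ u # bs" for as u bs
    using prefix_pth[of "last st"] stf that by metis
  let ?g = "f(y := st @ [y])"
  have "normal_tree (insert y S) adj r ?g"
  proof
    fix x as u bs assume x: "x \<in> insert y S" "?g x = as @ u # bs"
    show "?g u = as @ [u]"
    proof (cases "x = y")
      case True
      then have eq: "st @ [y] = as @ u # bs" using x by simp
      show ?thesis
      proof (cases bs rule: rev_cases)
        case Nil
        then show ?thesis using eq by simp
      next
        case (snoc bs' b)
        then have "st = as @ u # bs'" using eq by simp
        then show ?thesis using pre yst by auto
      qed
    next
      case False
      then have eq: "f x = as @ u # bs" "x \<in> S" using x by auto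
      then have "u \<in> S" using set_pth by fastforce
      then show ?thesis using prefix_pth[OF eq(2,1)] y by auto
    qed
  next
    fix x z assume xz: "x \<in> insert y S" "z \<in> insert y S" "adj x z"
    have nb: "w \<in> set st" if "w \<in> S" "adj w y" for w
      using st y(1,2) that unfolding dfs_state_def by blast
    show "x \<in> set (?g z) \<or> z \<in> set (?g x)"
      using xz nb[of x] nb[of z] comparable[of x z] y(2,4) sympD[OF sym]
      by (cases "x = y"; cases "z = y"; simp; blast)
  qed (use root_mem pth_ne hd_pth last_pth distinct_pth setf successively_pth stf stS yst dist hd succ y
      in \<open>auto simp: successively_append_iff\<close>)
  then show ?thesis
    using st y(1) unfolding dfs_state_def by simp blast
qed

lemma dfs_pop:
  assumes st: "dfs_state V adj r S f (st @ [x])" and ne: "st \<noteq> []"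
    and closed: "\<forall>y\<in>V. adj x y \<longrightarrow> y \<in> S"
  shows "dfs_state V adj r S f st"
proof -
  interpret normal_tree S adj r f using st by (simp add: dfs_state_def)
  have x: "f x = st @ [x]" "x \<in> S" using st by (auto simp: dfs_state_def)
  have eq: "f x = butlast st @ last st # [x]" using x ne by simp
  have "f (last st) = st" using prefix_pth[OF x(2) eq] ne by simp
  moreover have "last st \<in> S" using set_pth[OF x(2)] eq by auto
  moreover have "S \<subseteq> V" "\<forall>u\<in>S - insert x (set st). \<forall>y\<in>V. adj u y \<longrightarrow> y \<in> S"
    using st by (simp_all add: dfs_state_def)
  ultimately show ?thesis using normal_tree_axioms ne closed unfolding dfs_state_def by blast
qed

text \<open>A push trades an unvisited vertex of weight 2 for a stack entry of weight 1, and a pop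
  removes a stack entry, so both lower the measure. Paths once assigned never change, which is why
  \<open>g\<close> extends \<open>f\<close>.\<close>

lemma dfs_complete:
  assumes st: "dfs_state V adj r S f st" and fin: "finite V" and sym: "symp adj" and irr: "irreflp adj"
    and conn: "\<And>S. S \<subseteq> V \<Longrightarrow> S \<noteq> {} \<Longrightarrow> \<forall>x\<in>S. \<forall>y\<in>V. adj x y \<longrightarrow> y \<in> S \<Longrightarrow> S = V"
  shows "\<exists>g. normal_tree V adj r g \<and> (\<forall>x\<in>S. g x = f x)"
  using st
proof (induction "2 * card (V - S) + length st" arbitrary: S f st rule: less_induct)
  case less
  let ?x = "last st"
  have facts: "normal_tree S adj r f" "S \<subseteq> V" "st \<noteq> []" "?x \<in> S"
    "\<And>x y. x \<in> S \<Longrightarrow> x \<notin> set st \<Longrightarrow> y \<in> V \<Longrightarrow> adj x y \<Longrightarrow> y \<in> S"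
    using less.prems unfolding dfs_state_def by blast+
  show ?case
  proof (cases "\<exists>y\<in>V. y \<notin> S \<and> adj ?x y")
    case True
    then obtain y where y: "y \<in> V" "y \<notin> S" "adj ?x y" by blast
    have "dfs_state V adj r (insert y S) (f(y := st @ [y])) (st @ [y])"
      using dfs_push[OF less.prems sym y] irr by (auto dest: irreflpD)
    moreover have "card (V - S) = Suc (card (V - insert y S))"
      using y fin by (metis DiffI Diff_insert card.remove finite_Diff)
    ultimately have "\<exists>g. normal_tree V adj r g \<and> (\<forall>x\<in>insert y S. g x = (f(y := st @ [y])) x)"
      using less.hyps[of "insert y S" "st @ [y]" "f(y := st @ [y])"] by simp
    then show ?thesis using y by (metis fun_upd_other insertCI)
  next
    case False
    show ?thesis
    proof (cases "butlast st = []")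
      case True
      then have "set st = {?x}"
        using facts(3) by (cases st) (auto split: if_splits)
      then have "S = V"
        using facts False by (intro conn) (blast, blast, metis singletonD)
      then show ?thesis using facts(1) by blast
    next
      case ne: False
      have "butlast st @ [?x] = st" using facts(3) by simp
      then have "dfs_state V adj r S f (butlast st @ [?x])" using less.prems by simp
      from dfs_pop[OF this ne] False have "dfs_state V adj r S f (butlast st)"
        by blast
      moreover have "length (butlast st) < length st" using ne by (cases st) auto
      ultimately show ?thesis using less.hyps[of S "butlast st" f] by simp
    qed
  qed
qed

lemma normal_tree_extending_path:
  assumes p: "p \<noteq> []" "distinct p" "set p \<subseteq> V" "successively adj p"
    and fin: "finite V" and sym: "symp adj" and irr: "irreflp adj"
    and conn: "\<And>S. S \<subseteq> V \<Longrightarrow> S \<noteq> {} \<Longrightarrow> \<forall>x\<in>S. \<forall>y\<in>V. adj x y \<longrightarrow> y \<in> S \<Longrightarrow> S = V"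
  shows "\<exists>g. normal_tree V adj (hd p) g \<and> g (last p) = p"
proof -
  have "\<exists>f. dfs_state V adj (hd p) (set p) f p"
    using p
  proof (induction p rule: rev_nonempty_induct)
    case (single x)
    then show ?case using dfs_init[of x V adj] by auto
  next
    case (snoc x p)
    then obtain f where "dfs_state V adj (hd p) (set p) f p"
      by (auto simp: successively_append_iff)
    then have "dfs_state V adj (hd p) (insert x (set p)) (f(x := p @ [x])) (p @ [x])"
      using snoc irr by (intro dfs_push sym) (auto simp: successively_append_iff dest: irreflpD)
    then show ?case using snoc by auto
  qed
  then obtain f where f: "dfs_state V adj (hd p) (set p) f p" by blast
  obtain g where g: "normal_tree V adj (hd p) g" "\<forall>x\<in>set p. g x = f x"
    using dfs_complete[OF f fin sym irr conn] by blast
  then show ?thesis using f p by (auto simp: dfs_state_def)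
qed

section \<open>Indices and edge labels on a normal tree\<close>

text \<open>Having a single child makes up for the missing parent of the root when children are
  counted against \<open>k ^ d\<close>. As no leaf is adjacent to the root, its edges carry no
  digits, and the non-tree edge to \<open>z\<close> is free to mark it.\<close>

locale distinguishing_tree = normal_tree V adj r pth
  for V :: "'a set" and adj r pth +
  fixes k d :: nat and z :: 'a
  assumes finite_V: "finite V"
    and adj_sym: "adj x y \<Longrightarrow> adj y x"
    and adj_irrefl: "\<not> adj x x"
    and adj_mem: "adj x y \<Longrightarrow> x \<in> V"
    and k_ge_2: "2 \<le> k" and d_pos: "0 < d"
    and degree_ge: "x \<in> V \<Longrightarrow> d \<le> card {y. adj x y}"
    and degree_le: "x \<in> V \<Longrightarrow> card {y. adj x y} \<le> k ^ d"
    and root_child_unique: "child r x \<Longrightarrow> child r y \<Longrightarrow> x = y"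
    and root_nbr_not_leaf: "adj r x \<Longrightarrow> \<not> leaf x"
    and z_adj: "adj r z" and z_not_child: "\<not> child r z"
begin

lemma adj_mem2: "adj x y \<Longrightarrow> y \<in> V"
  using adj_sym adj_mem by blast

lemma finite_nbrs: "finite {y. adj x y}"
  by (rule finite_subset[OF _ finite_V]) (auto intro: adj_mem2)

definition children where "children x = {y. child x y}"

lemma children_nbrs: "children x \<subseteq> {y. adj x y}"
  using child_adj by (auto simp: children_def)

lemma finite_children: "finite (children x)"
  using children_nbrs finite_nbrs by (rule finite_subset)

definition siblings where "siblings y = {y' \<in> V. butlast (pth y') = butlast (pth y)}"

text \<open>The bijection is chosen for the sibling set, which all children of a vertex share, so
  one bijection numbers them all.\<close>

definition num where
  "num y = (SOME h. bij_betw h (siblings y) {..<card (siblings y)}) y"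

lemma num_bij: "bij_betw num (children x) {..<card (children x)}"
proof (cases "children x = {}")
  case False
  then have x: "x \<in> V" by (auto simp: children_def child_def)
  have sib: "siblings y = children x" if "y \<in> children x" for y
  proof -
    have "butlast (pth y) = pth x" using that by (simp add: children_def child_def)
    moreover have "butlast (pth u) = pth x \<longleftrightarrow> pth u = pth x @ [u]" if "u \<in> V" for u
      using butlast_pth[OF that] by (metis butlast_snoc)
    ultimately show ?thesis using x by (auto simp: siblings_def children_def child_def)
  qed
  define h where "h = (SOME h. bij_betw h (children x) {..<card (children x)})"
  have "bij_betw h (children x) {..<card (children x)}"
    unfolding h_def using ex_bij_betw_finite_nat[OF finite_children, of x]
    unfolding atLeast0LessThan by (rule someI_ex)
  moreover have "num y = h y" if "y \<in> children x" for y
    using sib[OF that] by (simp add: num_def h_def)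
  ultimately show ?thesis by (simp cong: bij_betw_cong)
qed (simp add: bij_betw_def)

text \<open>The rule that a child gets the index of its parent plus its own number, unrolled along
  the root path.\<close>

definition idx where "idx y = sum_list (map num (pth y)) mod k ^ d"

lemma idx_child: "child x y \<Longrightarrow> idx y = (idx x + num y) mod k ^ d"
  by (simp add: child_def idx_def mod_simps)

lemma pow_ge_2: "2 \<le> k ^ d"
  using k_ge_2 d_pos by (metis dual_order.trans self_le_power gr_implies_not0 le_less_trans one_le_numeral)

lemma idx_less: "idx x < k ^ d"
  using k_ge_2 by (simp add: idx_def)

text \<open>A vertex other than the root spends one of its at most \<open>k ^ d\<close> edges on its
  parent; the root has at most one child.\<close>

lemma card_children_less:
  assumes "x \<in> V"
  shows "card (children x) < k ^ d"
proof (cases "x = r")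
  case True
  have "card (children r) \<le> 1"
    using root_child_unique card_le_Suc0_iff_eq[OF finite_children, of r] by (auto simp: children_def)
  then show ?thesis using True pow_ge_2 by simp
next
  case False
  then obtain q where q: "child q x" using parent_exists assms by blast
  have "q \<notin> children x" using q by (auto simp: children_def child_def)
  moreover have "adj x q" using q child_adj adj_sym by blast
  ultimately have "children x \<subset> {y. adj x y}" using children_nbrs by blast
  then have "card (children x) < card {y. adj x y}" using finite_nbrs psubset_card_mono by blast
  then show ?thesis using degree_le[OF assms] by simp
qed

lemma idx_children:
  "idx ` children x = (\<lambda>i. (idx x + i) mod k ^ d) ` {..<card (children x)}"
proof -
  have "idx ` children x = (\<lambda>i. (idx x + i) mod k ^ d) ` num ` children x"
    unfolding image_image by (intro image_cong refl) (simp add: children_def idx_child)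
  then show ?thesis using num_bij[of x] by (simp add: bij_betw_def)
qed

lemma idx_inj_children:
  assumes x: "x \<in> V"
  shows "inj_on idx (children x)"
proof (rule inj_onI)
  fix u v assume uv: "u \<in> children x" "v \<in> children x" "idx u = idx v"
  have n: "num u < card (children x)" "num v < card (children x)"
    using num_bij[of x] uv unfolding bij_betw_def by blast+
  have "(idx x + num u) mod k ^ d = (idx x + num v) mod k ^ d"
    using uv idx_child by (simp add: children_def)
  then have "num u = num v" using n card_children_less[OF x] idx_less[of x]
    by (auto simp: mod_if split: if_splits)
  then show "u = v" using num_bij[of x] uv by (auto simp: bij_betw_def inj_on_def)
qed

text \<open>For a leaf \<open>l\<close>, whose neighbours form a chain, this is the position of
  \<open>a\<close> among them, counted from 0 at the root end.\<close>

definition rank where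
  "rank l a = card {b \<in> {b. adj l b}. length (pth b) < length (pth a)}"

definition digit where "digit l a = idx l div k ^ rank l a mod k"

text \<open>Digits are shifted up by 1, so that 0 is left to the tree edges between inner vertices.
  The label 1 serves both digits and the edge from \<open>r\<close> to \<open>z\<close>; these are
  told apart by whether an end is a leaf.\<close>

definition lab :: "'a \<Rightarrow> 'a \<Rightarrow> nat" where
  "lab x y =
    (if leaf x \<and> \<not> leaf y then 1 + digit x y
     else if leaf y \<and> \<not> leaf x then 1 + digit y x
     else if child x y \<or> child y x then 0
     else if {x, y} = {r, z} then 1 else 2)"

lemma lab_sym: "lab x y = lab y x"
  by (auto simp: lab_def)

lemma lab_le: "lab x y \<le> k"
  using k_ge_2 by (auto simp: lab_def digit_def Suc_le_eq)

lemma leaf_nbr: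
  assumes "leaf l" "adj l a"
  shows "a \<in> set (pth l)" "a \<noteq> l" "\<not> leaf a"
proof -
  have V: "l \<in> V" "a \<in> V" using assms adj_mem adj_mem2 by auto
  show ne: "a \<noteq> l" using assms adj_irrefl by auto
  then show "a \<in> set (pth l)"
    using comparable[OF V] assms proper_ancestor(1)[OF V(2), of l] by auto
  then show "\<not> leaf a" using proper_ancestor(1)[OF V(1)] ne by auto
qed

lemma lab_zero_iff:
  "adj x y \<Longrightarrow> lab x y = 0 \<longleftrightarrow> \<not> leaf x \<and> \<not> leaf y \<and> (child x y \<or> child y x)"
  using leaf_nbr(3)[of x y] by (auto simp: lab_def)

lemma child_not_leaf: "child x y \<Longrightarrow> \<not> leaf x"
  by (auto simp: leaf_def)

lemma has_child:
  assumes "\<not> leaf x" obtains y where "child x y"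
  using assms by (auto simp: leaf_def)

lemma root_not_leaf: "\<not> leaf r"
  using leaf_nbr(1,2)[OF _ z_adj] pth_root by auto

text \<open>This makes leaves recognisable from the labels. An inner vertex has an edge labelled 0
  to its parent; the root has one to its child, which is inner as a neighbour of the root.\<close>

lemma not_leaf_iff:
  assumes "x \<in> V"
  shows "\<not> leaf x \<longleftrightarrow> (\<exists>y. adj x y \<and> lab x y = 0)"
proof
  assume nl: "\<not> leaf x"
  show "\<exists>y. adj x y \<and> lab x y = 0"
  proof (cases "x = r")
    case True
    then obtain y where "child r y" using nl has_child by blast
    then show ?thesis using True nl lab_zero_iff child_adj root_nbr_not_leaf by blast
  next
    case False
    then obtain q where "child q x" using parent_exists assms by blast
    then show ?thesis using nl lab_zero_iff child_adj adj_sym child_not_leaf by blast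
  qed
qed (use lab_zero_iff in blast)

lemma z_not_leaf: "\<not> leaf z"
  using root_nbr_not_leaf z_adj .

lemma r_z_unique_one:
  assumes "adj x y" "\<not> leaf x" "\<not> leaf y" "lab x y = 1"
  shows "{x, y} = {r, z}"
  using assms by (auto simp: lab_def split: if_splits)

lemma lab_r_z: "lab r z = 1"
proof -
  have "\<not> child z r" using pth_root pth_ne[of z] by (auto simp: child_def)
  then show ?thesis using root_not_leaf z_not_leaf z_not_child by (simp add: lab_def)
qed

text \<open>A property invariant under label-preserving automorphisms that tells \<open>z\<close> from \<open>r\<close>.\<close>

definition rich where
  "rich x \<longleftrightarrow> (\<exists>l. adj x l \<and> leaf l) \<or>
     (\<exists>u v. adj x u \<and> adj x v \<and> lab x u = 0 \<and> lab x v = 0 \<and> u \<noteq> v)"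

text \<open>All neighbours of the root are inner, and only its edge to its single child is labelled
  0.\<close>

lemma not_rich_root: "\<not> rich r"
proof
  assume "rich r"
  then obtain u v where uv: "adj r u" "adj r v" "lab r u = 0" "lab r v = 0" "u \<noteq> v"
    unfolding rich_def using root_nbr_not_leaf by blast
  have "\<not> child u r" for u using pth_root pth_ne by (auto simp: child_def)
  then show False using uv lab_zero_iff root_child_unique by metis
qed

text \<open>Besides a parent, \<open>z\<close> has a child \<open>w\<close>. If \<open>w\<close> is
  a leaf, the first alternative holds; otherwise both tree edges are labelled 0.\<close>

lemma rich_z: "rich z"
proof -
  obtain w where w: "child z w" using has_child[OF z_not_leaf] .
  have "z \<noteq> r" using z_adj adj_irrefl by auto
  then obtain q where q: "child q z" using parent_exists z_adj adj_mem2 by metis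
  have "q \<noteq> w" using q w by (auto simp: child_def)
  then show ?thesis
    using q w lab_zero_iff[of z q] lab_zero_iff[of z w] child_adj adj_sym child_not_leaf z_not_leaf
    unfolding rich_def by metis
qed

end

section \<open>Automorphisms preserving the labels of the tree\<close>

locale tree_labeling_automorphism = distinguishing_tree +
  fixes \<phi> :: "'a \<Rightarrow> 'a"
  assumes phi_bij: "bij_betw \<phi> V V"
    and phi_adj: "x \<in> V \<Longrightarrow> y \<in> V \<Longrightarrow> adj (\<phi> x) (\<phi> y) \<longleftrightarrow> adj x y"
    and phi_lab: "adj x y \<Longrightarrow> lab (\<phi> x) (\<phi> y) = lab x y"
begin

lemma phi_mem: "x \<in> V \<Longrightarrow> \<phi> x \<in> V"
  using phi_bij by (auto simp: bij_betw_def)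

lemma phi_inj: "x \<in> V \<Longrightarrow> y \<in> V \<Longrightarrow> \<phi> x = \<phi> y \<longleftrightarrow> x = y"
  using phi_bij by (auto simp: bij_betw_def inj_on_def)

lemma phi_surj: assumes "y \<in> V" obtains x where "x \<in> V" "y = \<phi> x"
  using phi_bij assms by (auto simp: bij_betw_def)

lemma nbr_image:
  assumes "x \<in> V" shows "{y. adj (\<phi> x) y} = \<phi> ` {y. adj x y}"
proof (intro equalityI subsetI)
  fix y assume "y \<in> {y. adj (\<phi> x) y}"
  then have y: "adj (\<phi> x) y" by simp
  then obtain u where "u \<in> V" "y = \<phi> u" using phi_surj adj_mem2 by blast
  then show "y \<in> \<phi> ` {y. adj x y}" using y phi_adj assms by auto
qed (use phi_adj assms adj_mem2 in auto)

lemma phi_adj_obtain: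
  assumes "x \<in> V" "adj (\<phi> x) y" obtains y' where "adj x y'" "y = \<phi> y'"
  using nbr_image[OF assms(1)] assms(2) by auto

lemma phi_leaf: "x \<in> V \<Longrightarrow> leaf (\<phi> x) \<longleftrightarrow> leaf x"
proof -
  assume x: "x \<in> V"
  have "(\<exists>y. adj (\<phi> x) y \<and> lab (\<phi> x) y = 0) \<longleftrightarrow> (\<exists>y\<in>{y. adj (\<phi> x) y}. lab (\<phi> x) y = 0)"
    by simp
  also have "\<dots> \<longleftrightarrow> (\<exists>y. adj x y \<and> lab x y = 0)"
    unfolding nbr_image[OF x] using phi_lab by auto
  finally show ?thesis using not_leaf_iff[OF x] not_leaf_iff[OF phi_mem[OF x]] by blast
qed

lemma phi_rich: assumes x: "x \<in> V" shows "rich (\<phi> x) \<longleftrightarrow> rich x"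
proof
  assume "rich x"
  then show "rich (\<phi> x)"
    unfolding rich_def using x phi_adj phi_lab phi_leaf phi_inj adj_mem2 by metis
next
  assume "rich (\<phi> x)"
  then show "rich x"
    unfolding rich_def using x phi_adj phi_lab phi_leaf adj_mem2 phi_adj_obtain[OF x] by metis
qed

text \<open>The edge from \<open>r\<close> to \<open>z\<close> is the only one labelled 1 between
  inner vertices, so it is mapped to itself; \<open>rich\<close> rules out a swap of its
  ends.\<close>

lemma phi_root: "\<phi> r = r"
proof -
  have V: "r \<in> V" "z \<in> V" using z_adj adj_mem adj_mem2 by auto
  have "{\<phi> r, \<phi> z} = {r, z}"
    using r_z_unique_one[of "\<phi> r" "\<phi> z"] phi_adj[OF V] phi_leaf V phi_lab[OF z_adj] lab_r_z z_adj
      root_not_leaf z_not_leaf by simp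
  then have "\<phi> r = r \<or> \<phi> r = z" by (auto simp: doubleton_eq_iff)
  then show ?thesis using phi_rich[OF V(1)] not_rich_root rich_z by auto
qed

lemma phi_pth_nonleaf:
  "x \<in> V \<Longrightarrow> \<not> leaf x \<Longrightarrow> pth (\<phi> x) = map \<phi> (pth x)"
proof (induction "length (pth x)" arbitrary: x rule: less_induct)
  case less
  show ?case
  proof (cases "x = r")
    case True
    then show ?thesis by (simp add: phi_root pth_root)
  next
    case False
    then obtain q where q: "child q x" using parent_exists less.prems by blast
    then have qV: "q \<in> V" and px: "pth x = pth q @ [x]" by (auto simp: child_def)
    have nq: "\<not> leaf q" using q child_not_leaf by blast
    have IH: "pth (\<phi> q) = map \<phi> (pth q)" using less.hyps px qV nq by simp
    have "lab q x = 0" using lab_zero_iff q child_adj nq less.prems by blast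
    then have "lab (\<phi> q) (\<phi> x) = 0" using phi_lab child_adj[OF q] by simp
    then consider "child (\<phi> q) (\<phi> x)" | "child (\<phi> x) (\<phi> q)"
      using lab_zero_iff[of "\<phi> q" "\<phi> x"] phi_adj qV less.prems child_adj[OF q] by blast
    then show ?thesis
    proof cases
      case 1
      then show ?thesis using IH px by (simp add: child_def)
    next
      \<comment> \<open>If the image edge were reversed, \<open>\<phi> x\<close> would lie on the
        root path of \<open>\<phi> q\<close>, which is the image of that of \<open>q\<close>; then
        \<open>x\<close> would be an ancestor of its own parent.\<close>
      case 2
      then have "\<phi> x \<in> set (pth (\<phi> q))"
        using self_in_pth[of "\<phi> x"] by (auto simp: child_def)
      then obtain u where u: "u \<in> set (pth q)" "\<phi> u = \<phi> x" using IH by auto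
      then have "x \<in> set (pth q)" using phi_inj set_pth[OF qV] less.prems by blast
      then show ?thesis using distinct_pth[OF less.prems(1)] px by simp
    qed
  qed
qed

text \<open>No label singles out the tree edge at a leaf, but the parent is the deepest neighbour.
  If \<open>a\<close> is mapped to the parent of \<open>\<phi> l\<close>, then \<open>a\<close> and
  the parent \<open>q\<close> of \<open>l\<close> lie on each other's root paths and are
  equal.\<close>

lemma phi_pth_leaf:
  assumes l: "l \<in> V" "leaf l"
  shows "pth (\<phi> l) = map \<phi> (pth l)"
proof -
  have "l \<noteq> r" using l root_not_leaf by auto
  then obtain q where q: "child q l" using parent_exists l by blast
  have lq: "adj l q" using q child_adj adj_sym by blast
  have pl: "leaf (\<phi> l)" "\<phi> l \<in> V" using l phi_leaf phi_mem by auto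
  have "\<phi> l \<noteq> r" using pl root_not_leaf by auto
  then obtain q' where q': "child q' (\<phi> l)" using parent_exists pl by blast
  then have "adj (\<phi> l) q'" using child_adj adj_sym by blast
  then obtain a where a: "adj l a" "q' = \<phi> a" using phi_adj_obtain l by blast
  have aV: "a \<in> V" and qV: "q \<in> V" using a lq adj_mem2 by auto
  have pa: "pth q' = map \<phi> (pth a)"
    using phi_pth_nonleaf[OF aV] leaf_nbr(3)[OF l(2) a(1)] a by simp
  have "adj (\<phi> l) (\<phi> q)" using phi_adj l qV lq by blast
  then have "\<phi> q \<in> set (pth (\<phi> l))" "\<phi> q \<noteq> \<phi> l" using leaf_nbr pl by blast+
  then have "\<phi> q \<in> set (pth q')" using q' by (auto simp: child_def)
  then obtain u where "u \<in> set (pth a)" "\<phi> u = \<phi> q" using pa by auto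
  then have qa: "q \<in> set (pth a)" using phi_inj set_pth[OF aV] qV by blast
  have "a \<in> set (pth l)" "a \<noteq> l" using leaf_nbr l a by blast+
  then have aq: "a \<in> set (pth q)" using q by (auto simp: child_def)
  have "a = q"
    using proper_ancestor(2)[OF aV qa] proper_ancestor(2)[OF qV aq] by force
  then show ?thesis using q q' a pa by (simp add: child_def)
qed

lemma phi_pth: "x \<in> V \<Longrightarrow> pth (\<phi> x) = map \<phi> (pth x)"
  using phi_pth_leaf phi_pth_nonleaf by blast

lemma phi_child:
  assumes "x \<in> V" "y \<in> V"
  shows "child (\<phi> x) (\<phi> y) \<longleftrightarrow> child x y"
proof -
  have "inj_on \<phi> V" using phi_bij by (simp add: bij_betw_def)
  moreover have "set (pth y) \<union> set (pth x @ [y]) \<subseteq> V" using set_pth assms by auto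
  ultimately have "map \<phi> (pth y) = map \<phi> (pth x @ [y]) \<longleftrightarrow> pth y = pth x @ [y]"
    by (intro inj_on_map_eq_map) (rule inj_on_subset)
  then show ?thesis using assms phi_mem phi_pth by (simp add: child_def)
qed

lemma phi_children: "x \<in> V \<Longrightarrow> children (\<phi> x) = \<phi> ` children x"
proof (intro equalityI subsetI)
  fix y assume x: "x \<in> V" and "y \<in> children (\<phi> x)"
  then have y: "child (\<phi> x) y" by (simp add: children_def)
  then have "y \<in> V" by (simp add: child_def)
  then obtain u where "u \<in> V" "y = \<phi> u" using phi_surj by blast
  then show "y \<in> \<phi> ` children x" using y phi_child x by (auto simp: children_def)
next
  fix y assume x: "x \<in> V" and "y \<in> \<phi> ` children x"
  then obtain u where u: "child x u" "y = \<phi> u" by (auto simp: children_def)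
  then have "u \<in> V" by (simp add: child_def)
  then show "y \<in> children (\<phi> x)" using u phi_child x by (simp add: children_def)
qed

lemma phi_rank:
  assumes "l \<in> V" "a \<in> V"
  shows "rank (\<phi> l) (\<phi> a) = rank l a"
proof -
  have "{b \<in> {b. adj (\<phi> l) b}. length (pth b) < length (pth (\<phi> a))}
      = \<phi> ` {b \<in> {b. adj l b}. length (pth b) < length (pth a)}"
    using phi_pth adj_mem2 assms unfolding nbr_image[OF assms(1)] by auto
  moreover have "inj_on \<phi> {b \<in> {b. adj l b}. length (pth b) < length (pth a)}"
    by (rule inj_onI) (use phi_inj adj_mem2 in auto)
  ultimately show ?thesis unfolding rank_def by (simp add: card_image)
qed

text \<open>The edge to the neighbour of rank \<open>i\<close> carries digit \<open>i\<close>, and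
  since the degree is at least \<open>d\<close>, all \<open>d\<close> digits are present.\<close>

lemma phi_idx_leaf:
  assumes l: "l \<in> V" "leaf l"
  shows "idx (\<phi> l) = idx l"
proof -
  have "idx (\<phi> l) div k ^ i mod k = idx l div k ^ i mod k" if i: "i < d" for i
  proof -
    have "inj_on (\<lambda>x. length (pth x)) {a. adj l a}"
      by (rule inj_on_subset[OF chain_pth_inj[OF l(1)]]) (use leaf_nbr l in auto)
    moreover have "i < card {a. adj l a}" using i degree_ge[OF l(1)] by simp
    ultimately obtain a where a: "adj l a" "rank l a = i"
      using exists_rank[OF finite_nbrs] unfolding rank_def by blast
    have aV: "a \<in> V" using a adj_mem2 by blast
    have "\<not> leaf a" using leaf_nbr l a by blast
    then have "digit (\<phi> l) (\<phi> a) = digit l a"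
      using phi_lab[OF a(1)] phi_leaf l aV by (simp add: lab_def)
    then show ?thesis using phi_rank[OF l(1) aV] a by (simp add: digit_def)
  qed
  then have "idx (\<phi> l) mod k ^ d = idx l mod k ^ d" by (rule mod_power_digits_eq)
  then show ?thesis using idx_less by simp
qed

text \<open>Induction from the deepest vertices upwards: equal indices on the children force the two
  cyclic intervals to start at the same point.\<close>

lemma phi_idx: "x \<in> V \<Longrightarrow> idx (\<phi> x) = idx x"
proof (induction "card V - length (pth x)" arbitrary: x rule: less_induct)
  case less
  show ?case
  proof (cases "leaf x")
    case True
    then show ?thesis using phi_idx_leaf less.prems by blast
  next
    case False
    have "idx (\<phi> y) = idx y" if y: "y \<in> children x" for y
    proof (rule less.hyps)
      show yV: "y \<in> V" using y by (simp add: children_def child_def)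
      have "length (pth y) \<le> card V"
        using distinct_card[OF distinct_pth[OF yV]] card_mono[OF finite_V set_pth[OF yV]] by simp
      then show "card V - length (pth y) < card V - length (pth x)"
        using y by (auto simp: children_def child_def)
    qed
    then have "idx ` children (\<phi> x) = idx ` children x"
      using phi_children[OF less.prems] by (simp add: image_image cong: image_cong)
    moreover have "card (children (\<phi> x)) = card (children x)"
      unfolding phi_children[OF less.prems]
      by (intro card_image inj_onI) (use phi_inj in \<open>auto simp: children_def child_def\<close>)
    ultimately have "(\<lambda>i. (idx (\<phi> x) + i) mod k ^ d) ` {..<card (children x)}
        = (\<lambda>i. (idx x + i) mod k ^ d) ` {..<card (children x)}"
      using idx_children[of x] idx_children[of "\<phi> x"] by simp
    moreover have "0 < card (children x)"
      using False finite_children by (auto simp: card_gt_0_iff children_def leaf_def)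
    ultimately show ?thesis
      using cyclic_window_start_unique card_children_less[OF less.prems] idx_less by blast
  qed
qed

lemma phi_id: "x \<in> V \<Longrightarrow> \<phi> x = x"
proof (induction "length (pth x)" arbitrary: x rule: less_induct)
  case less
  show ?case
  proof (cases "x = r")
    case True
    then show ?thesis using phi_root by simp
  next
    case False
    then obtain q where q: "child q x" using parent_exists less.prems by blast
    then have qV: "q \<in> V" "\<phi> q = q" using less.hyps by (auto simp: child_def)
    then have "x \<in> children q" "\<phi> x \<in> children q"
      using q phi_child[OF qV(1) less.prems] by (auto simp: children_def)
    then show ?thesis
      using idx_inj_children[OF qV(1)] phi_idx[OF less.prems] by (auto dest: inj_onD)
  qed
qed

end

section \<open>Rigid labelings and the case of a spanning path\<close>

text \<open>The distinguishing property for a bare adjacency relation and labels of ordered pairs,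
  the common form of both constructions.\<close>

definition rigid_labeling :: "'a set \<Rightarrow> ('a \<Rightarrow> 'a \<Rightarrow> bool) \<Rightarrow> ('a \<Rightarrow> 'a \<Rightarrow> 'l) \<Rightarrow> bool" where
  "rigid_labeling V adj f \<longleftrightarrow> (\<forall>\<phi>. bij_betw \<phi> V V \<longrightarrow>
     (\<forall>x\<in>V. \<forall>y\<in>V. adj (\<phi> x) (\<phi> y) \<longleftrightarrow> adj x y) \<longrightarrow>
     (\<forall>x y. adj x y \<longrightarrow> f (\<phi> x) (\<phi> y) = f x y) \<longrightarrow> (\<forall>x\<in>V. \<phi> x = x))"

lemma (in distinguishing_tree) lab_rigid: "rigid_labeling V adj lab"
  unfolding rigid_labeling_def
proof (intro allI impI ballI)
  fix \<phi> x
  assume "bij_betw \<phi> V V" "\<forall>x\<in>V. \<forall>y\<in>V. adj (\<phi> x) (\<phi> y) \<longleftrightarrow> adj x y"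
    "\<forall>x y. adj x y \<longrightarrow> lab (\<phi> x) (\<phi> y) = lab x y" and x: "x \<in> V"
  then interpret tree_labeling_automorphism V adj r pth k d z \<phi>
    by unfold_locales auto
  show "\<phi> x = x" using phi_id x .
qed

definition path_lab :: "'a list \<Rightarrow> 'a \<Rightarrow> 'a \<Rightarrow> nat" where
  "path_lab p x y =
    (if {x, y} = {p ! 0, p ! 1} then 1
     else if \<exists>i. Suc i < length p \<and> {x, y} = {p ! i, p ! Suc i} then 0 else 2)"

text \<open>The edge labelled 1 is kept, and its ends cannot be swapped since only the second one
  lies on an edge labelled 0. From there the edges labelled 0 lead along the path, and injectivity
  excludes turning back.\<close>

lemma path_lab_rigid:
  assumes p: "distinct p" "set p = V" "successively adj p" "3 \<le> length p"
  shows "rigid_labeling V adj (path_lab p)"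
  unfolding rigid_labeling_def
proof (intro allI impI)
  fix \<phi>
  assume phi: "bij_betw \<phi> V V" and lab: "\<forall>x y. adj x y \<longrightarrow> path_lab p (\<phi> x) (\<phi> y) = path_lab p x y"
  have len: "0 < length p" "1 < length p" using p(4) by auto
  have nth: "p ! i = p ! j \<longleftrightarrow> i = j" if "i < length p" "j < length p" for i j
    using nth_eq_iff_index_eq p(1) that by blast
  have inj: "\<phi> (p ! i) = \<phi> (p ! j) \<longleftrightarrow> i = j" if "i < length p" "j < length p" for i j
  proof -
    have "p ! i \<in> V" "p ! j \<in> V" using p(2) that by auto
    then show ?thesis using phi nth[OF that] unfolding bij_betw_def inj_on_def by blast
  qed
  have adj: "adj (p ! i) (p ! Suc i)" if "Suc i < length p" for i
    using p(3) that by (simp add: successively_conv_nth)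
  have lab0: "\<exists>j. 0 < j \<and> Suc j < length p \<and> {\<phi> (p ! i), \<phi> (p ! Suc i)} = {p ! j, p ! Suc j}"
    if i: "0 < i" "Suc i < length p" for i
  proof -
    have "{p ! i, p ! Suc i} \<noteq> {p ! 0, p ! 1}"
      using i len nth[of i 0] nth[of i 1] nth[of "Suc i" 0] nth[of "Suc i" 1]
      by (auto simp: doubleton_eq_iff)
    then have "path_lab p (p ! i) (p ! Suc i) = 0" using i by (auto simp: path_lab_def)
    then have "path_lab p (\<phi> (p ! i)) (\<phi> (p ! Suc i)) = 0" using lab adj[OF i(2)] by simp
    then obtain j where "{\<phi> (p ! i), \<phi> (p ! Suc i)} \<noteq> {p ! 0, p ! 1}" "Suc j < length p"
      "{\<phi> (p ! i), \<phi> (p ! Suc i)} = {p ! j, p ! Suc j}"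
      by (auto simp: path_lab_def split: if_splits)
    then show ?thesis by (intro exI[of _ j]) (cases j; auto)
  qed
  have "path_lab p (p ! 0) (p ! 1) = 1" by (simp add: path_lab_def)
  moreover have "adj (p ! 0) (p ! 1)" using adj[of 0] p(4) by simp
  ultimately have "path_lab p (\<phi> (p ! 0)) (\<phi> (p ! 1)) = 1" using lab by simp
  then have "{\<phi> (p ! 0), \<phi> (p ! 1)} = {p ! 0, p ! 1}"
    by (simp only: path_lab_def split: if_splits)
  moreover have "\<phi> (p ! 1) \<noteq> p ! 0"
  proof
    assume eq: "\<phi> (p ! 1) = p ! 0"
    \<comment> \<open>The edge from \<open>p ! 1\<close> to \<open>p ! 2\<close> exists since
      \<open>p\<close> has length at least 3; its image would be an edge labelled 0 at
      \<open>p ! 0\<close>.\<close>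
    obtain j where "0 < j" "Suc j < length p" "{p ! 0, \<phi> (p ! Suc 1)} = {p ! j, p ! Suc j}"
      using lab0[of 1] p(4) eq by auto
    then show False using nth[of 0 j] nth[of 0 "Suc j"] len by (auto simp: doubleton_eq_iff)
  qed
  ultimately have start: "\<phi> (p ! 0) = p ! 0" "\<phi> (p ! 1) = p ! 1"
    by (auto simp: doubleton_eq_iff)
  have "\<phi> (p ! i) = p ! i" if "i < length p" for i
    using that
  proof (induction i rule: less_induct)
    case (less i)
    consider "i = 0" | "i = 1" | h where "i = Suc (Suc h)"
      by (metis One_nat_def not0_implies_Suc)
    then show ?case
    proof cases
      case 3
      have fix1: "\<phi> (p ! Suc h) = p ! Suc h" "\<phi> (p ! h) = p ! h" using less 3 by auto
      obtain j where j: "0 < j" "Suc j < length p" "{p ! Suc h, \<phi> (p ! i)} = {p ! j, p ! Suc j}"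
        using lab0[of "Suc h"] less.prems 3 fix1 by auto
      then consider "p ! Suc h = p ! j" "\<phi> (p ! i) = p ! Suc j"
        | "p ! Suc h = p ! Suc j" "\<phi> (p ! i) = p ! j"
        by (auto simp: doubleton_eq_iff)
      then show ?thesis
      proof cases
        case 1
        then show ?thesis using nth[of "Suc h" j] j less.prems 3 by simp
      next
        case 2
        then have "\<phi> (p ! i) = \<phi> (p ! h)" using nth[of "Suc h" "Suc j"] j less.prems 3 fix1 by simp
        then show ?thesis using inj[of i h] less.prems 3 by simp
      qed
    qed (use start in auto)
  qed
  then show "\<forall>x\<in>V. \<phi> x = x" using p(2) by (metis in_set_conv_nth)
qed

section \<open>Longest paths and existence of a rigid labeling\<close>

text \<open>Connectedness appears as \<open>closed_eq\<close>, the form needed both when the search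
  stops and for leaving a path that is not spanning.\<close>

locale connected_graph =
  fixes V :: "'a set" and adj :: "'a \<Rightarrow> 'a \<Rightarrow> bool"
  assumes finite_V: "finite V" and nonempty: "V \<noteq> {}"
    and sym: "symp adj" and irrefl: "irreflp adj"
    and adj_mem: "adj x y \<Longrightarrow> x \<in> V"
    and closed_eq: "S \<subseteq> V \<Longrightarrow> S \<noteq> {} \<Longrightarrow> \<forall>x\<in>S. \<forall>y\<in>V. adj x y \<longrightarrow> y \<in> S \<Longrightarrow> S = V"
begin

definition is_path where "is_path p \<longleftrightarrow> distinct p \<and> set p \<subseteq> V \<and> successively adj p"

lemma longest_path:
  obtains p where "is_path p" "\<And>q. is_path q \<Longrightarrow> length q \<le> length p"
proof -
  have "length q \<le> card V" if "is_path q" for q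
    using that card_mono[OF finite_V] distinct_card[of q] by (auto simp: is_path_def) metis
  moreover have "is_path []" by (simp add: is_path_def)
  ultimately have "\<exists>p. is_path p \<and> (\<forall>q. is_path q \<longrightarrow> length q \<le> length p)"
    by (intro ex_has_greatest_nat[where b = "Suc (card V)"]) (auto simp: less_Suc_eq_le)
  then show ?thesis using that by blast
qed

text \<open>A neighbour of the first vertex off \<open>p\<close> could be prepended. If the ends
  were adjacent, \<open>p\<close> could be rotated to start at any of its vertices; connectedness
  supplies such a vertex \<open>x\<close> with a neighbour \<open>y\<close> off \<open>p\<close>,
  which could then be prepended.\<close>

lemma longest_path_nbrs:
  assumes p: "is_path p" "\<And>q. is_path q \<Longrightarrow> length q \<le> length p" and ne: "p \<noteq> []"
  shows "adj (hd p) y \<Longrightarrow> y \<in> set p"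
    and "\<lbrakk>set p \<noteq> V; adj (hd p) (last p)\<rbrakk> \<Longrightarrow> False"
proof -
  assume y: "adj (hd p) y"
  have "y \<in> V" using y sym adj_mem by (metis sympD)
  then have "is_path (y # p)" if "y \<notin> set p"
    using that p(1) ne y sym by (cases p) (auto simp: is_path_def dest: sympD)
  then show "y \<in> set p" using p(2)[of "y # p"] by auto
next
  assume npq: "set p \<noteq> V" and hl: "adj (hd p) (last p)"
  have "\<not> (\<forall>x\<in>set p. \<forall>y\<in>V. adj x y \<longrightarrow> y \<in> set p)"
    using closed_eq[of "set p"] p(1) ne npq by (auto simp: is_path_def)
  then obtain x y where xy: "x \<in> set p" "y \<in> V" "adj x y" "y \<notin> set p" by blast
  obtain as bs where eq: "p = as @ x # bs" using xy(1) by (meson split_list)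
  have "adj (last p) (hd p)" "adj y x" using hl xy sym by (auto dest: sympD)
  moreover have "successively adj as" "successively adj (x # bs)"
    using p(1) eq by (auto simp: is_path_def successively_append_iff)
  ultimately have "successively adj ([y] @ (x # bs) @ as)"
    unfolding successively_append_iff using eq by (cases as) auto
  then have "is_path (y # x # bs @ as)"
    using p(1) xy eq by (auto simp: is_path_def)
  then show False using p(2)[of "y # x # bs @ as"] eq by simp
qed

theorem rigid_labeling_exists:
  fixes d k :: nat
  assumes d: "2 \<le> d" and k: "2 \<le> k"
    and deg_ge: "\<And>x. x \<in> V \<Longrightarrow> d \<le> card {y. adj x y}"
    and deg_le: "\<And>x. x \<in> V \<Longrightarrow> card {y. adj x y} \<le> k ^ d"
  shows "\<exists>f. (\<forall>x y. f x y = f y x) \<and> (\<forall>x y. f x y \<le> k) \<and> rigid_labeling V adj f"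
proof -
  obtain p where p: "is_path p" and longest: "\<And>q. is_path q \<Longrightarrow> length q \<le> length p"
    using longest_path by blast
  obtain v where "v \<in> V" using nonempty by blast
  then have "is_path [v]" by (simp add: is_path_def)
  then have ne: "p \<noteq> []" using longest[of "[v]"] by auto
  note nbrs = longest_path_nbrs[OF p longest ne]
  have p': "distinct p" "set p \<subseteq> V" "successively adj p" using p by (auto simp: is_path_def)
  have rV: "hd p \<in> V" using ne p' by auto
  have len: "3 \<le> length p"
  proof -
    have "insert (hd p) {y. adj (hd p) y} \<subseteq> set p" using nbrs(1) ne by auto
    then have "card (insert (hd p) {y. adj (hd p) y}) \<le> length p"
      by (meson card_mono List.finite_set card_length order_trans)
    moreover have "finite {y. adj (hd p) y}" using nbrs(1) by (auto intro: finite_subset[of _ "set p"])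
    moreover have "hd p \<notin> {y. adj (hd p) y}" using irrefl by (auto dest: irreflpD)
    ultimately show ?thesis using deg_ge[OF rV] d by simp
  qed
  show ?thesis
  proof (cases "set p = V")
    case True
    have "path_lab p x y = path_lab p y x" for x y
      by (simp add: path_lab_def insert_commute)
    moreover have "path_lab p x y \<le> k" for x y using k by (simp add: path_lab_def)
    ultimately show ?thesis using path_lab_rigid[OF p'(1) True p'(3) len] by blast
  next
    case False
    obtain pth where tree: "normal_tree V adj (hd p) pth" and pl: "pth (last p) = p"
      using normal_tree_extending_path[OF ne p' finite_V sym irrefl closed_eq] by blast
    interpret normal_tree V adj "hd p" pth by (rule tree)
    have lV: "last p \<in> V" using ne p' by auto
    have pth_take: "pth (p ! i) = take (Suc i) p" if "i < length p" for i
      using prefix_pth[OF lV, of "take i p" "p ! i" "drop (Suc i) p"] that pl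
      by (simp add: id_take_nth_drop[symmetric] take_Suc_conv_app_nth)
    \<comment> \<open>Children of the root lie on \<open>p\<close>, where root paths are initial
      segments of \<open>p\<close>, so depth decides.\<close>
    have root_child: "x = p ! 1" if "child (hd p) x" for x
    proof -
      have "x \<in> set p" using nbrs(1) child_adj[OF that] by blast
      then obtain i where i: "i < length p" "x = p ! i" by (auto simp: in_set_conv_nth)
      have "length (pth x) = 2" using that pth_root by (simp add: child_def)
      then show ?thesis using pth_take[OF i(1)] i by simp
    qed
    \<comment> \<open>A neighbour of the root lies on \<open>p\<close> but is not its last vertex,
      so it is a proper ancestor of that vertex.\<close>
    have nbr_nonleaf: "\<not> leaf x" if "adj (hd p) x" for x
    proof -
      have "x \<in> set p" using nbrs(1) that by blast
      moreover have "x \<noteq> last p" using nbrs(2) that False by blast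
      ultimately show ?thesis using proper_ancestor(1)[OF lV] pl by simp
    qed
    \<comment> \<open>As \<open>d\<close> is at least 2, the root has a neighbour besides its only
      possible child; it serves as \<open>z\<close>.\<close>
    have "\<not> {y. adj (hd p) y} \<subseteq> {p ! 1}"
      using deg_ge[OF rV] d card_mono[of "{p ! 1}" "{y. adj (hd p) y}"] by auto
    then obtain z where z: "adj (hd p) z" "z \<noteq> p ! 1" by auto
    interpret distinguishing_tree V adj "hd p" pth k d z
    proof
      show "adj y x" if "adj x y" for x y using that sym by (auto dest: sympD)
      show "x = y" if "child (hd p) x" "child (hd p) y" for x y
        using root_child that by metis
      show "\<not> adj x x" for x using irrefl by (auto dest: irreflpD)
    qed (use finite_V adj_mem d k deg_ge deg_le nbr_nonleaf z root_child in auto)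
    show ?thesis using lab_sym lab_le lab_rigid by blast
  qed
qed

end

section \<open>Transfer to the distinguishing index\<close>

lemma symmetric_function_of_doubleton:
  fixes f :: "'a \<Rightarrow> 'a \<Rightarrow> 'b"
  assumes "\<And>x y. f x y = f y x"
  obtains c where "\<And>x y. c {x, y} = f x y"
proof
  fix x y
  let ?c = "\<lambda>e. SOME n. \<exists>x y. e = {x, y} \<and> n = f x y"
  have "\<exists>u v. {x, y} = {u, v} \<and> ?c {x, y} = f u v"
    by (rule someI_ex) blast
  then show "?c {x, y} = f x y" using assms by (auto simp: doubleton_eq_iff)
qed

lemma out_degree_with_proj: "out_degree (with_proj G) v = card {w. (v, w) \<in> parcs G}"
proof -
  have "out_arcs (with_proj G) v = Pair v ` {w. (v, w) \<in> parcs G}"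
    by (auto simp: out_arcs_def)
  then show ?thesis by (simp add: out_degree_def card_image inj_on_def)
qed

lemma (in pair_graph) connected_graph_parcs:
  assumes "Digraph_Component.connected (with_proj G)"
  shows "connected_graph (pverts G) (\<lambda>u w. (u, w) \<in> parcs G)"
proof
  have sc: "strongly_connected (with_proj G)"
    using symmetric_connected_imp_strongly_connected pair_sym_arcs assms by blast
  show "pverts G \<noteq> {}" using sc by (simp add: strongly_connected_def)
  show "symp (\<lambda>u w. (u, w) \<in> parcs G)"
    using pair_sym_arcs by (auto simp: symmetric_def sym_def intro: sympI)
  show "irreflp (\<lambda>u w. (u, w) \<in> parcs G)"
    using pair_no_loops by (force intro: irreflpI)
  show "S = pverts G" if S: "S \<subseteq> pverts G" "S \<noteq> {}"
    and closed: "\<forall>x\<in>S. \<forall>y\<in>pverts G. (x, y) \<in> parcs G \<longrightarrow> y \<in> S" for S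
  proof (rule equalityI[OF S(1)], rule subsetI)
    fix v assume v: "v \<in> pverts G"
    obtain u where u: "u \<in> S" using S by blast
    have "u \<rightarrow>\<^sup>*\<^bsub>with_proj G\<^esub> v" using sc u v S by (auto simp: strongly_connected_def)
    then show "v \<in> S"
      by (induction rule: reachable_induct) (use u closed in_arcsD2 in auto)
  qed
qed (use pair_finite_verts in_arcsD1 in auto)

theorem theorem2p3:
  fixes G :: "'a pair_pre_digraph"
  assumes "pair_graph G"
    and "Digraph_Component.connected (with_proj G)"
    and "min_degree G \<ge> 2"
  shows "distinguishing_index G
           \<le> enat (nat \<lceil>root (min_degree G) (real (max_degree G))\<rceil> + 1)"
proof -
  interpret pair_graph G by fact
  let ?adj = "\<lambda>u w. (u, w) \<in> parcs G"
  interpret connected_graph "pverts G" ?adj by (rule connected_graph_parcs) fact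
  define d where "d = min_degree G"
  define k where "k = nat \<lceil>root d (real (max_degree G))\<rceil>"
  have min: "d \<le> card {w. ?adj v w}" and max: "card {w. ?adj v w} \<le> max_degree G"
    if "v \<in> pverts G" for v
    using that pair_finite_verts unfolding d_def min_degree_def max_degree_def
    by (auto simp flip: out_degree_with_proj)
  have d: "2 \<le> d" using assms(3) by (simp add: d_def)
  have "2 \<le> max_degree G" using nonempty min max d by (meson all_not_in_conv le_trans)
  have root_le: "root d (real (max_degree G)) \<le> real k"
    unfolding k_def by linarith
  \<comment> \<open>Being strictly above 1, the root has a ceiling of at least 2, so the label 2 is
    available.\<close>
  have "1 < root d (real (max_degree G))" using d \<open>2 \<le> max_degree G\<close> by simp
  then have k: "2 \<le> k" using root_le by linarith
  have "real (max_degree G) = root d (real (max_degree G)) ^ d" using d by simp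
  also have "\<dots> \<le> real k ^ d" using root_le \<open>1 < root d _\<close> by (intro power_mono) linarith+
  finally have "max_degree G \<le> k ^ d" by (simp flip: of_nat_power)
  then have "card {w. ?adj v w} \<le> k ^ d" if "v \<in> pverts G" for v
    using max[OF that] by simp
  then obtain f where f: "\<And>x y. f x y = f y x" "\<And>x y. f x y \<le> k"
    and rigid: "rigid_labeling (pverts G) ?adj f"
    using rigid_labeling_exists[OF d k min] by blast
  obtain c where c: "\<And>x y. c {x, y} = f x y"
    using symmetric_function_of_doubleton[of f] f(1) by blast
  \<comment> \<open>The values 0 to \<open>k\<close> account for the summand 1 in the bound.\<close>
  have "c ` edges G \<subseteq> {..<k + 1}" using f(2) c by (auto simp: edges_def less_Suc_eq_le)
  moreover have "distinguishing_labeling G c"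
    unfolding distinguishing_labeling_def
  proof (intro allI impI)
    fix \<phi> assume \<phi>: "graph_automorphism G \<phi> \<and> preserves_labeling G \<phi> c"
    then have "f (\<phi> x) (\<phi> y) = f x y" if "?adj x y" for x y
      using that c unfolding preserves_labeling_def edges_def by fastforce
    then show "\<forall>v\<in>pverts G. \<phi> v = v"
      using rigid \<phi> unfolding rigid_labeling_def graph_automorphism_def by blast
  qed
  ultimately have "distinguishing_index G \<le> enat (k + 1)"
    unfolding distinguishing_index_def by (intro Inf_lower) blast
  then show ?thesis by (simp add: k_def d_def)
qed

end
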